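(* Let $\beta\in\mathbb{R}$ and fix $\boldsymbol{u}\in\mathbb{R}^d$. Let $w(\boldsymbol{u},\cdot):(\beta,+\infty)\to\mathbb{R}$ and $\eta:(\beta,+\infty)\times(\beta,+\infty)\to\mathbb{R}$ be continuous. Let $\eta=\eta(s,b)$ be bounded and Lipschitz continuous in its first variable, i.e. there is $L\ge 0$ with $|\eta(s,b)-\eta(s',b)|\le L|s-s'|$ for all $s,s',b>\beta$. Assume that for each $s>\beta$ the functions $\eta(s,\cdot)$, $w(\boldsymbol{u},\cdot)$ and $w(\boldsymbol{u},\cdot)\,\eta(s,\cdot)$ belong to $L_2((\beta,+\infty))\cap L_1((\beta,+\infty))$, and that the product $w(\boldsymbol{u},\cdot)\,\eta(s,\cdot)$ is Riemann integrable. For $s>\beta$ define $$\tilde g(\boldsymbol{u},s)=\int_s^{+\infty} w(\boldsymbol{u},b)\,\eta(s,b)\,db.$$ Let $\beta_1,\beta_2>\beta$. If $\beta_1\to\beta_2$, then $|\tilde g(\boldsymbol{u},\beta_1)-\tilde g(\boldsymbol{u},\beta_2)|\to 0$.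
   Context: The function $\tilde g(\cdot,s)$ plays the role of the scaling function of a variably scaled kernel interpolant in a parametric imaging problem with parameter $s$; this role is not used in the claim. Riemann integrability on the half-line is understood in the improper sense. *)

theory Defs
  imports "HOL-Analysis.Analysis"
begin

text \<open>
  Riemann integrability on a compact interval, in the classical sense: Riemann sums over all tagged
  partitions converge as the mesh tends to 0. (\<open>has_integral\<close> of the library is the gauge
  integral, for which the mesh bound may depend on the tag.)
\<close>

definition has_riemann_integral :: "(real \<Rightarrow> real) \<Rightarrow> real \<Rightarrow> real \<Rightarrow> real \<Rightarrow> bool" where
  "has_riemann_integral f I a b \<longleftrightarrow>
     (\<forall>e>0. \<exists>\<delta>>0. \<forall>p. p tagged_division_of {a..b} \<and> (\<forall>(x, K)\<in>p. diameter K < \<delta>) \<longrightarrow>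
        \<bar>(\<Sum>(x, K)\<in>p. measure lborel K * f x) - I\<bar> < e)"

definition riemann_integrable :: "(real \<Rightarrow> real) \<Rightarrow> real \<Rightarrow> real \<Rightarrow> bool" where
  "riemann_integrable f a b \<longleftrightarrow> (\<exists>I. has_riemann_integral f I a b)"

definition riemann_integral :: "(real \<Rightarrow> real) \<Rightarrow> real \<Rightarrow> real \<Rightarrow> real" where
  "riemann_integral f a b = (THE I. has_riemann_integral f I a b)"

text \<open>
  Improper Riemann integrability on the open half-line \<open>{a<..}\<close>. Both ends are improper:
  the function need not be bounded (or even meaningful) at \<open>a\<close>.
\<close>

definition improper_riemann_integrable :: "(real \<Rightarrow> real) \<Rightarrow> real \<Rightarrow> bool" where
  "improper_riemann_integrable f a \<longleftrightarrow>
     (\<forall>c d. a < c \<and> c \<le> d \<longrightarrow> riemann_integrable f c d) \<and>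
     (\<forall>m>a. (\<exists>l. ((\<lambda>d. riemann_integral f m d) \<longlongrightarrow> l) at_top) \<and>
            (\<exists>l. ((\<lambda>c. riemann_integral f c m) \<longlongrightarrow> l) (at_right a)))"

definition in_Lp :: "real \<Rightarrow> real set \<Rightarrow> (real \<Rightarrow> real) \<Rightarrow> bool" where
  "in_Lp p A f \<longleftrightarrow>
     set_borel_measurable lebesgue A f \<and> set_integrable lebesgue A (\<lambda>x. \<bar>f x\<bar> powr p)"

text \<open>
  The integral is the Lebesgue integral; for integrands in \<open>L\<^sub>1\<close> that are improperly Riemann
  integrable it agrees with the improper Riemann integral.
\<close>

definition g_tilde ::
  "('u \<Rightarrow> real \<Rightarrow> real) \<Rightarrow> (real \<Rightarrow> real \<Rightarrow> real) \<Rightarrow> 'u \<Rightarrow> real \<Rightarrow> real" where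
  "g_tilde w \<eta> u s = (LINT b:{s<..}|lebesgue. w u b * \<eta> s b)"

end

theory Submission
  imports Defs
begin

text \<open>
  Dominated convergence along \<open>s \<rightarrow> \<beta>\<^sub>2\<close>: with \<open>M\<close> a bound for \<open>\<eta>\<close>, the function \<open>M \<bar>w\<bar>\<close> dominates
  all the integrands, and \<open>indicator {s<..} b * w b * \<eta> s b\<close> converges for every \<open>b \<noteq> \<beta>\<^sub>2\<close>.
\<close>

text \<open>Off \<open>c\<close> the indicator is eventually constant in \<open>n\<close>: 0 if
  \<open>b < c\<close>, 1 if \<open>b > c\<close>. At \<open>b = c\<close> it may oscillate, as
  \<open>X\<close> can approach from both sides. Convergence of \<open>f\<close> is asked for only
  where the limiting indicator is 1; for \<open>b < c\<close> the scaled terms are eventually 0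
  whatever \<open>f\<close> does.\<close>

lemma tendsto_indicator_greaterThan_scaleR:
  fixes f :: "nat \<Rightarrow> 'a::real_normed_vector" and X :: "nat \<Rightarrow> 'b::linorder_topology"
  assumes X: "X \<longlonglongrightarrow> c" and f: "b > c \<Longrightarrow> f \<longlonglongrightarrow> l" and "b \<noteq> c"
  shows "(\<lambda>n. indicator {X n<..} b *\<^sub>R f n) \<longlonglongrightarrow> indicator {c<..} b *\<^sub>R l"
proof (cases "b < c")
  case True
  with X have "\<forall>\<^sub>F n in sequentially. X n > b"
    by (simp add: order_tendstoD)
  then have "\<forall>\<^sub>F n in sequentially. indicator {X n<..} b *\<^sub>R f n = indicator {c<..} b *\<^sub>R l"
    by eventually_elim (use True in auto)
  then show ?thesis by (rule tendsto_eventually)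
next
  case False
  with \<open>b \<noteq> c\<close> have "b > c" by simp
  then have "\<forall>\<^sub>F n in sequentially. X n < b"
    using X by (simp add: order_tendstoD)
  then have "\<forall>\<^sub>F n in sequentially. f n = indicator {X n<..} b *\<^sub>R f n"
    by eventually_elim auto
  with f[OF \<open>b > c\<close>] have "(\<lambda>n. indicator {X n<..} b *\<^sub>R f n) \<longlonglongrightarrow> l"
    by (rule Lim_transform_eventually)
  with \<open>b > c\<close> show ?thesis by simp
qed

theorem proposition2p2:
  fixes \<beta> :: real
    and u :: "real ^ 'd"
    and w :: "real ^ 'd \<Rightarrow> real \<Rightarrow> real"
    and \<eta> :: "real \<Rightarrow> real \<Rightarrow> real"
    and L :: real
    and \<beta>\<^sub>2 :: real
  assumes w_cont: "continuous_on {\<beta><..} (w u)"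
    and \<eta>_cont: "continuous_on ({\<beta><..} \<times> {\<beta><..}) (\<lambda>(s, b). \<eta> s b)"
    and \<eta>_bounded: "bounded ((\<lambda>(s, b). \<eta> s b) ` ({\<beta><..} \<times> {\<beta><..}))"
    and L_nonneg: "L \<ge> 0"
    and \<eta>_lipschitz:
      "\<And>s s' b. s > \<beta> \<Longrightarrow> s' > \<beta> \<Longrightarrow> b > \<beta> \<Longrightarrow> \<bar>\<eta> s b - \<eta> s' b\<bar> \<le> L * \<bar>s - s'\<bar>"
    and \<eta>_L1: "\<And>s. s > \<beta> \<Longrightarrow> in_Lp 1 {\<beta><..} (\<eta> s)"
    and \<eta>_L2: "\<And>s. s > \<beta> \<Longrightarrow> in_Lp 2 {\<beta><..} (\<eta> s)"
    and w_L1: "in_Lp 1 {\<beta><..} (w u)"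
    and w_L2: "in_Lp 2 {\<beta><..} (w u)"
    and w\<eta>_L1: "\<And>s. s > \<beta> \<Longrightarrow> in_Lp 1 {\<beta><..} (\<lambda>b. w u b * \<eta> s b)"
    and w\<eta>_L2: "\<And>s. s > \<beta> \<Longrightarrow> in_Lp 2 {\<beta><..} (\<lambda>b. w u b * \<eta> s b)"
    and w\<eta>_riemann: "\<And>s. s > \<beta> \<Longrightarrow> improper_riemann_integrable (\<lambda>b. w u b * \<eta> s b) \<beta>"
    and \<beta>\<^sub>2: "\<beta>\<^sub>2 > \<beta>"
  shows "((\<lambda>\<beta>\<^sub>1. \<bar>g_tilde w \<eta> u \<beta>\<^sub>1 - g_tilde w \<eta> u \<beta>\<^sub>2\<bar>) \<longlongrightarrow> 0) (at \<beta>\<^sub>2 within {\<beta><..})"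
proof -
  obtain M where M: "\<bar>\<eta> s b\<bar> \<le> M" if "s > \<beta>" "b > \<beta>" for s b
    using \<eta>_bounded unfolding bounded_iff by auto
  \<comment> \<open>Extending by zero moves the varying domain into the integrand, so that all
    integrals are taken over the whole line.\<close>
  define F where "F s b = indicator {s<..} b *\<^sub>R (w u b * \<eta> s b)" for s b
  have F_measurable: "F s \<in> borel_measurable lebesgue" if "s > \<beta>" for s
  proof -
    have "set_borel_measurable lebesgue {s<..} (\<lambda>b. w u b * \<eta> s b)"
      by (rule set_borel_measurable_subset[where A = "{\<beta><..}"])
        (use w\<eta>_L1[OF that] that in \<open>auto simp: in_Lp_def\<close>)
    then show ?thesis
      unfolding set_borel_measurable_def F_def .
  qed
  \<comment> \<open>Dominated convergence is applied to sequences; the limit within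
    \<open>{\<beta><..}\<close> is recovered from them at the end.\<close>
  have "(\<lambda>n. g_tilde w \<eta> u (X n)) \<longlonglongrightarrow> g_tilde w \<eta> u \<beta>\<^sub>2"
    if X: "\<And>n. X n > \<beta>" "X \<longlonglongrightarrow> \<beta>\<^sub>2" for X
  proof -
    have "(\<lambda>n. \<integral>b. F (X n) b \<partial>lebesgue) \<longlonglongrightarrow> (\<integral>b. F \<beta>\<^sub>2 b \<partial>lebesgue)"
    proof (rule integral_dominated_convergence[where w = "\<lambda>b. M * (indicator {\<beta><..} b * \<bar>w u b\<bar>)"])
      show "integrable lebesgue (\<lambda>b. M * (indicator {\<beta><..} b * \<bar>w u b\<bar>))"
        \<comment> \<open>For exponent 1, \<open>\<bar>w u b\<bar> powr 1\<close> is just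
          \<open>\<bar>w u b\<bar>\<close>.\<close>
        using w_L1 by (intro integrable_mult_right) (simp add: in_Lp_def set_integrable_def)
      have "AE b in lebesgue. b \<noteq> \<beta>\<^sub>2"
        by (rule AE_completion[OF AE_lborel_singleton])
      then show "AE b in lebesgue. (\<lambda>n. F (X n) b) \<longlonglongrightarrow> F \<beta>\<^sub>2 b"
      proof eventually_elim
        case (elim b)
        \<comment> \<open>Here \<open>b > \<beta>\<^sub>2 > \<beta>\<close>, so the Lipschitz bound
          is available and squeezes the difference of the \<eta> values to 0.\<close>
        have "(\<lambda>n. w u b * \<eta> (X n) b) \<longlonglongrightarrow> w u b * \<eta> \<beta>\<^sub>2 b" if "b > \<beta>\<^sub>2"
        proof (rule tendsto_mult_left, rule LIM_zero_cancel, rule Lim_null_comparison)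
          show "\<forall>\<^sub>F n in sequentially. norm (\<eta> (X n) b - \<eta> \<beta>\<^sub>2 b) \<le> L * \<bar>X n - \<beta>\<^sub>2\<bar>"
            using \<eta>_lipschitz X(1) \<beta>\<^sub>2 that by simp
          show "(\<lambda>n. L * \<bar>X n - \<beta>\<^sub>2\<bar>) \<longlonglongrightarrow> 0"
            using X(2) by (intro tendsto_mult_right_zero tendsto_rabs_zero LIM_zero)
        qed
        then show ?case
          unfolding F_def by (rule tendsto_indicator_greaterThan_scaleR[OF X(2) _ elim])
      qed
      show "AE b in lebesgue. norm (F (X n) b) \<le> M * (indicator {\<beta><..} b * \<bar>w u b\<bar>)" for n
      proof (intro AE_I2)
        fix b
        show "norm (F (X n) b) \<le> M * (indicator {\<beta><..} b * \<bar>w u b\<bar>)"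
        proof (cases "b > \<beta>")
          case True
          have "\<bar>w u b\<bar> * \<bar>\<eta> (X n) b\<bar> \<le> \<bar>w u b\<bar> * M"
            by (intro mult_left_mono M X True) simp
          \<comment> \<open>The sign of \<open>M\<close> matters when \<beta> < \<open>b\<close> and
            \<open>b \<le> X n\<close>: there \<open>F (X n) b\<close> is 0 and the claim reduces to
            nonnegativity of the dominating function.\<close>
          moreover have "0 \<le> M"
            using M[OF X(1) True, of n] by linarith
          ultimately show ?thesis
            using True by (auto simp: F_def abs_mult mult.commute indicator_def)
        next
          case False
          \<comment> \<open>Now \<open>b \<le> \<beta> < X n\<close>, so both indicators
            vanish.\<close>
          with X(1)[of n] show ?thesis by (simp add: F_def)
        qed
      qed
    qed (use F_measurable X \<beta>\<^sub>2 in auto)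
    then show ?thesis
      by (simp add: F_def g_tilde_def set_lebesgue_integral_def)
  qed
  then have "(g_tilde w \<eta> u \<longlongrightarrow> g_tilde w \<eta> u \<beta>\<^sub>2) (at \<beta>\<^sub>2 within {\<beta><..})"
    by (auto simp: tendsto_at_iff_sequentially o_def)
  then show ?thesis
    by (intro tendsto_rabs_zero LIM_zero)
qed

end
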